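(* Let $V$ be a commutative, unital, integral, non-trivial quantale whose underlying lattice is a frame. \begin{itemize} \item The full subcategory $V\text{-}\mathsf{Grp}_{\mathsf{sep}}$ is reflective in $V\text{-}\mathsf{Grp}$, and each component of the unit of the adjunction, given at $(X,a)$ by the quotient $\eta_X:(X,a)\to(X/N_X,\bar a)$, is a normal epimorphism. \item The full subcategory $V\text{-}\mathsf{Grp}_{\mathsf{ind}}$ is coreflective in $V\text{-}\mathsf{Grp}$, and each component of the counit of the adjunction, given at $(X,a)$ by the inclusion $k_X:(N_X,\tilde a)\to(X,a)$, is a normal monomorphism. \end{itemize}
   Context: Quantales. A commutative unital quantale $V$ is a complete lattice (bottom $\bot$, top $\top$) with an associative, commutative operation $\otimes$ with unit $k$, preserving arbitrary joins in each variable (in particular $v\otimes\bot=\bot$). $V$ is non-trivial if $\bot\neq\top$, integral if $k=\top$. It is assumed that $V$ is a frame, i.e. arbitrary joins distribute over finite meets. $V$-groups. A $V$-relation $a$ on a set $X$ is a function $a:X\times X\to V$. A $V$-category is a pair $(X,a)$ with $k\le a(x,x)$ and $a(x,x')\otimes a(x',x'')\le a(x,x'')$ for all $x,x',x''\in X$. A $V$-group is a $V$-category $(X,a)$ with a (not necessarily abelian) group structure $(X,+,-,0)$ such that $a(x_1,x_2)\otimes a(x_1',x_2')\le a(x_1+x_1',x_2+x_2')$ for all elements of $X$; equivalently, a $V$-category with a group structure such that $a(x',x'')=a(x'+x,x''+x)$ for all $x,x',x''$. A $V$-homomorphism $f:(X,a)\to(Y,b)$ is a group homomorphism with $a(x,x')\le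 b(f(x),f(x'))$ for all $x,x'\in X$. $V$-groups and $V$-homomorphisms form the category $V\text{-}\mathsf{Grp}$; it is pointed when $V$ is integral. A normal epimorphism (monomorphism) is a cokernel (kernel) of some morphism. A $V$-group $(X,a)$ is indiscrete if $a(x,x')=\top$ for all $x,x'\in X$; it is separated if $a(x,x')\ge k$ and $a(x',x)\ge k$ imply $x=x'$. The corresponding full subcategories of $V\text{-}\mathsf{Grp}$ are $V\text{-}\mathsf{Grp}_{\mathsf{ind}}$ and $V\text{-}\mathsf{Grp}_{\mathsf{sep}}$. For a $V$-group $(X,a)$, $N_X=\{x\in X\mid a(0,x)\ge k \text{ and } a(x,0)\ge k\}$, a normal subgroup of $X$; $k_X:N_X\to X$ is the inclusion, $\tilde a$ is the restriction of $a$ to $N_X$; $\eta_X:X\to X/N_X$ is the quotient map and $\bar a(z_1,z_2)=\bigvee_{\eta_X(x_i)=z_i}a(x_1,x_2)$. *)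

theory Defs
  imports "HOL-Algebra.Coset"
begin

section \<open>Categories, adjunctions, normal epimorphisms and monomorphisms\<close>

record ('o, 'm) cat =
  Obj :: "'o set"
  Arr :: "'m set"
  Dom :: "'m \<Rightarrow> 'o"
  Cod :: "'m \<Rightarrow> 'o"
  Ident :: "'o \<Rightarrow> 'm"
  Comp :: "'m \<Rightarrow> 'm \<Rightarrow> 'm"  (* Comp C g f is "g after f" *)

definition homset :: "('o, 'm) cat \<Rightarrow> 'o \<Rightarrow> 'o \<Rightarrow> 'm set" where
  "homset C A B = {f \<in> Arr C. Dom C f = A \<and> Cod C f = B}"

definition is_category :: "('o, 'm) cat \<Rightarrow> bool" where
  "is_category C \<longleftrightarrow>
     (\<forall>f\<in>Arr C. Dom C f \<in> Obj C \<and> Cod C f \<in> Obj C) \<and>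
     (\<forall>A\<in>Obj C. Ident C A \<in> homset C A A) \<and>
     (\<forall>f\<in>Arr C. \<forall>g\<in>Arr C. Cod C f = Dom C g \<longrightarrow>
        Comp C g f \<in> homset C (Dom C f) (Cod C g)) \<and>
     (\<forall>f\<in>Arr C. Comp C f (Ident C (Dom C f)) = f \<and> Comp C (Ident C (Cod C f)) f = f) \<and>
     (\<forall>f\<in>Arr C. \<forall>g\<in>Arr C. \<forall>h\<in>Arr C. Cod C f = Dom C g \<and> Cod C g = Dom C h \<longrightarrow>
        Comp C h (Comp C g f) = Comp C (Comp C h g) f)"

definition full_subcat :: "('o, 'm) cat \<Rightarrow> ('o \<Rightarrow> bool) \<Rightarrow> ('o, 'm) cat" where
  "full_subcat C P = C\<lparr>Obj := {A \<in> Obj C. P A},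
                       Arr := {f \<in> Arr C. P (Dom C f) \<and> P (Cod C f)}\<rparr>"

record ('o, 'm, 'p, 'n) func =
  fobj :: "'o \<Rightarrow> 'p"
  farr :: "'m \<Rightarrow> 'n"

definition is_functor :: "('o, 'm) cat \<Rightarrow> ('p, 'n) cat \<Rightarrow> ('o, 'm, 'p, 'n) func \<Rightarrow> bool" where
  "is_functor C D F \<longleftrightarrow> is_category C \<and> is_category D \<and>
     (\<forall>A\<in>Obj C. fobj F A \<in> Obj D) \<and>
     (\<forall>f\<in>Arr C. farr F f \<in> homset D (fobj F (Dom C f)) (fobj F (Cod C f))) \<and>
     (\<forall>A\<in>Obj C. farr F (Ident C A) = Ident D (fobj F A)) \<and>
     (\<forall>f\<in>Arr C. \<forall>g\<in>Arr C. Cod C f = Dom C g \<longrightarrow>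
        farr F (Comp C g f) = Comp D (farr F g) (farr F f))"

(* Serves both as the identity functor and as the inclusion of a subcategory. *)
definition incl_func :: "('o, 'm, 'o, 'm) func" where
  "incl_func = \<lparr>fobj = (\<lambda>A. A), farr = (\<lambda>f. f)\<rparr>"

definition comp_func ::
  "('p, 'n, 'q, 'l) func \<Rightarrow> ('o, 'm, 'p, 'n) func \<Rightarrow> ('o, 'm, 'q, 'l) func" where
  "comp_func G F = \<lparr>fobj = fobj G \<circ> fobj F, farr = farr G \<circ> farr F\<rparr>"

definition nat_trans :: "('o, 'm) cat \<Rightarrow> ('p, 'n) cat \<Rightarrow>
    ('o, 'm, 'p, 'n) func \<Rightarrow> ('o, 'm, 'p, 'n) func \<Rightarrow> ('o \<Rightarrow> 'n) \<Rightarrow> bool" where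
  "nat_trans C D F G \<tau> \<longleftrightarrow> is_functor C D F \<and> is_functor C D G \<and>
     (\<forall>A\<in>Obj C. \<tau> A \<in> homset D (fobj F A) (fobj G A)) \<and>
     (\<forall>f\<in>Arr C. Comp D (\<tau> (Cod C f)) (farr F f) = Comp D (farr G f) (\<tau> (Dom C f)))"

text \<open>\<open>F : C \<rightarrow> D\<close> is left adjoint to \<open>G : D \<rightarrow> C\<close> with unit \<open>\<eta>\<close> and counit \<open>\<epsilon>\<close>.\<close>

definition adjunction :: "('o, 'm) cat \<Rightarrow> ('p, 'n) cat \<Rightarrow>
    ('o, 'm, 'p, 'n) func \<Rightarrow> ('p, 'n, 'o, 'm) func \<Rightarrow> ('o \<Rightarrow> 'm) \<Rightarrow> ('p \<Rightarrow> 'n) \<Rightarrow> bool" where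
  "adjunction C D F G \<eta> \<epsilon> \<longleftrightarrow>
     is_functor C D F \<and> is_functor D C G \<and>
     nat_trans C C incl_func (comp_func G F) \<eta> \<and>
     nat_trans D D (comp_func F G) incl_func \<epsilon> \<and>
     (\<forall>A\<in>Obj C. Comp D (\<epsilon> (fobj F A)) (farr F (\<eta> A)) = Ident D (fobj F A)) \<and>
     (\<forall>B\<in>Obj D. Comp C (farr G (\<epsilon> B)) (\<eta> (fobj G B)) = Ident C (fobj G B))"

text \<open>The full subcategory on the objects satisfying \<open>P\<close> is reflective with reflector \<open>R\<close> and
  unit \<open>\<eta>\<close>, respectively coreflective with coreflector \<open>R\<close> and counit \<open>\<epsilon>\<close>.\<close>

definition reflection ::
  "('o, 'm) cat \<Rightarrow> ('o \<Rightarrow> bool) \<Rightarrow> ('o, 'm, 'o, 'm) func \<Rightarrow> ('o \<Rightarrow> 'm) \<Rightarrow> bool" where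
  "reflection C P R \<eta> \<longleftrightarrow> (\<exists>\<epsilon>. adjunction C (full_subcat C P) R incl_func \<eta> \<epsilon>)"

definition coreflection ::
  "('o, 'm) cat \<Rightarrow> ('o \<Rightarrow> bool) \<Rightarrow> ('o, 'm, 'o, 'm) func \<Rightarrow> ('o \<Rightarrow> 'm) \<Rightarrow> bool" where
  "coreflection C P R \<epsilon> \<longleftrightarrow> (\<exists>\<eta>. adjunction (full_subcat C P) C incl_func R \<eta> \<epsilon>)"

definition zero_obj :: "('o, 'm) cat \<Rightarrow> 'o \<Rightarrow> bool" where
  "zero_obj C Z \<longleftrightarrow> Z \<in> Obj C \<and>
     (\<forall>A\<in>Obj C. (\<exists>!f. f \<in> homset C A Z) \<and> (\<exists>!f. f \<in> homset C Z A))"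

definition zero_arr :: "('o, 'm) cat \<Rightarrow> 'm \<Rightarrow> bool" where
  "zero_arr C f \<longleftrightarrow> f \<in> Arr C \<and>
     (\<exists>Z g h. zero_obj C Z \<and> g \<in> homset C (Dom C f) Z \<and> h \<in> homset C Z (Cod C f) \<and>
              f = Comp C h g)"

definition is_cokernel :: "('o, 'm) cat \<Rightarrow> 'm \<Rightarrow> 'm \<Rightarrow> bool" where
  "is_cokernel C f q \<longleftrightarrow> f \<in> Arr C \<and> q \<in> Arr C \<and> Dom C q = Cod C f \<and> zero_arr C (Comp C q f) \<and>
     (\<forall>h\<in>Arr C. Dom C h = Cod C f \<and> zero_arr C (Comp C h f) \<longrightarrow>
        (\<exists>!u. u \<in> homset C (Cod C q) (Cod C h) \<and> Comp C u q = h))"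

definition is_kernel :: "('o, 'm) cat \<Rightarrow> 'm \<Rightarrow> 'm \<Rightarrow> bool" where
  "is_kernel C f m \<longleftrightarrow> f \<in> Arr C \<and> m \<in> Arr C \<and> Cod C m = Dom C f \<and> zero_arr C (Comp C f m) \<and>
     (\<forall>h\<in>Arr C. Cod C h = Dom C f \<and> zero_arr C (Comp C f h) \<longrightarrow>
        (\<exists>!u. u \<in> homset C (Dom C h) (Dom C m) \<and> Comp C m u = h))"

definition normal_epi :: "('o, 'm) cat \<Rightarrow> 'm \<Rightarrow> bool" where
  "normal_epi C q \<longleftrightarrow> (\<exists>f. is_cokernel C f q)"

definition normal_mono :: "('o, 'm) cat \<Rightarrow> 'm \<Rightarrow> bool" where
  "normal_mono C m \<longleftrightarrow> (\<exists>f. is_kernel C f m)"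


section \<open>Quantales\<close>

locale comm_unital_quantale =
  fixes tensor :: "'v::complete_lattice \<Rightarrow> 'v \<Rightarrow> 'v"
    and k :: 'v
  assumes tensor_assoc: "tensor (tensor u v) w = tensor u (tensor v w)"
    and tensor_comm: "tensor u v = tensor v u"
    and tensor_unit: "tensor k v = v"
    and tensor_Sup_right: "tensor v (Sup S) = (SUP s\<in>S. tensor v s)"
    and tensor_Sup_left: "tensor (Sup S) v = (SUP s\<in>S. tensor s v)"

(* The library class complete_distrib_lattice is complete distributivity, which is stronger. *)
definition is_frame :: "'v::complete_lattice itself \<Rightarrow> bool" where
  "is_frame _ \<longleftrightarrow> (\<forall>(v::'v) S. inf v (Sup S) = (SUP s\<in>S. inf v s))"


section \<open>The category of V-groups\<close>

text \<open>The group, written additively in the mathematical literature but not assumed abelian, is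
  a multiplicative group in the sense of \<open>HOL-Algebra\<close>; the \<open>V\<close>-relation is \<open>vrel\<close>. Values of the
  operations outside the carrier are irrelevant: they can only produce several isomorphic copies
  of the same \<open>V\<close>-group.\<close>

record ('u, 'v) vgroup = "'u monoid" +
  vrel :: "'u \<Rightarrow> 'u \<Rightarrow> 'v"

definition is_vcategory :: "('v::complete_lattice \<Rightarrow> 'v \<Rightarrow> 'v) \<Rightarrow> 'v \<Rightarrow>
    'u set \<Rightarrow> ('u \<Rightarrow> 'u \<Rightarrow> 'v) \<Rightarrow> bool" where
  "is_vcategory tensor k X a \<longleftrightarrow>
     (\<forall>x\<in>X. k \<le> a x x) \<and>
     (\<forall>x\<in>X. \<forall>x'\<in>X. \<forall>x''\<in>X. tensor (a x x') (a x' x'') \<le> a x x'')"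

definition is_vgroup ::
  "('v::complete_lattice \<Rightarrow> 'v \<Rightarrow> 'v) \<Rightarrow> 'v \<Rightarrow> ('u, 'v) vgroup \<Rightarrow> bool" where
  "is_vgroup tensor k X \<longleftrightarrow> group X \<and> is_vcategory tensor k (carrier X) (vrel X) \<and>
     (\<forall>x1\<in>carrier X. \<forall>x2\<in>carrier X. \<forall>y1\<in>carrier X. \<forall>y2\<in>carrier X.
        tensor (vrel X x1 x2) (vrel X y1 y2) \<le> vrel X (x1 \<otimes>\<^bsub>X\<^esub> y1) (x2 \<otimes>\<^bsub>X\<^esub> y2))"

definition vhom :: "('u, 'v::complete_lattice) vgroup \<Rightarrow> ('w, 'v) vgroup \<Rightarrow> ('u \<Rightarrow> 'w) set" where
  "vhom X Y = {f \<in> hom X Y. \<forall>x\<in>carrier X. \<forall>x'\<in>carrier X. vrel X x x' \<le> vrel Y (f x) (f x')}"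

text \<open>Isomorphism of \<open>V\<close>-groups, possibly with carriers in different types.\<close>

definition viso :: "('u, 'v::complete_lattice) vgroup \<Rightarrow> ('w, 'v) vgroup \<Rightarrow> ('u \<Rightarrow> 'w) set" where
  "viso X Y = {f \<in> vhom X Y. bij_betw f (carrier X) (carrier Y) \<and>
                             inv_into (carrier X) f \<in> vhom Y X}"

datatype ('u, 'v) varrow = VArrow
  (vdom: "('u, 'v) vgroup") (vcod: "('u, 'v) vgroup") (vmap: "'u \<Rightarrow> 'u")

text \<open>All \<open>V\<close>-groups with carrier a subset of the type \<open>'u\<close>, which plays the role of the universe.
  Underlying maps are extensional, so that arrows are equal iff they agree on the carrier of
  their common domain.\<close>

definition VGrp :: "('v::complete_lattice \<Rightarrow> 'v \<Rightarrow> 'v) \<Rightarrow> 'v \<Rightarrow>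
    (('u, 'v) vgroup, ('u, 'v) varrow) cat" where
  "VGrp tensor k = \<lparr>
     Obj = {X. is_vgroup tensor k X},
     Arr = {f. is_vgroup tensor k (vdom f) \<and> is_vgroup tensor k (vcod f) \<and>
               vmap f \<in> vhom (vdom f) (vcod f) \<and> vmap f \<in> extensional (carrier (vdom f))},
     Dom = vdom,
     Cod = vcod,
     Ident = (\<lambda>X. VArrow X X (\<lambda>x\<in>carrier X. x)),
     Comp = (\<lambda>g f. VArrow (vdom f) (vcod g) (compose (carrier (vdom f)) (vmap g) (vmap f)))\<rparr>"

definition indiscrete :: "('u, 'v::complete_lattice) vgroup \<Rightarrow> bool" where
  "indiscrete X \<longleftrightarrow> (\<forall>x\<in>carrier X. \<forall>x'\<in>carrier X. vrel X x x' = Orderings.top)"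

definition separated :: "'v::complete_lattice \<Rightarrow> ('u, 'v) vgroup \<Rightarrow> bool" where
  "separated k X \<longleftrightarrow> (\<forall>x\<in>carrier X. \<forall>x'\<in>carrier X.
     k \<le> vrel X x x' \<and> k \<le> vrel X x' x \<longrightarrow> x = x')"

definition Nset :: "'v::complete_lattice \<Rightarrow> ('u, 'v) vgroup \<Rightarrow> 'u set" where
  "Nset k X = {x \<in> carrier X. k \<le> vrel X \<one>\<^bsub>X\<^esub> x \<and> k \<le> vrel X x \<one>\<^bsub>X\<^esub>}"

definition Nobj :: "'v::complete_lattice \<Rightarrow> ('u, 'v) vgroup \<Rightarrow> ('u, 'v) vgroup" where
  "Nobj k X = X\<lparr>carrier := Nset k X\<rparr>"

definition Nincl :: "'v::complete_lattice \<Rightarrow> ('u, 'v) vgroup \<Rightarrow> ('u, 'v) varrow" where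
  "Nincl k X = VArrow (Nobj k X) X (\<lambda>x\<in>Nset k X. x)"

definition quot_map :: "'v::complete_lattice \<Rightarrow> ('u, 'v) vgroup \<Rightarrow> 'u \<Rightarrow> 'u set" where
  "quot_map k X x = Nset k X #>\<^bsub>X\<^esub> x"

definition quot_vgroup :: "'v::complete_lattice \<Rightarrow> ('u, 'v) vgroup \<Rightarrow> ('u set, 'v) vgroup" where
  "quot_vgroup k X = \<lparr>
     carrier = carrier (X Mod Nset k X),
     mult = mult (X Mod Nset k X),
     one = one (X Mod Nset k X),
     vrel = (\<lambda>z1 z2. Sup {vrel X x1 x2 | x1 x2. x1 \<in> carrier X \<and> x2 \<in> carrier X \<and>
                            quot_map k X x1 = z1 \<and> quot_map k X x2 = z2})\<rparr>"

text \<open>The quotient \<open>X/N\<^sub>X\<close> has carrier in \<open>'u set\<close>, not in \<open>'u\<close>. An arrow of the category is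
  given by the quotient map if it becomes the quotient map after an isomorphism of \<open>V\<close>-groups
  from \<open>X/N\<^sub>X\<close> to its codomain.\<close>

definition is_quot_arrow :: "'v::complete_lattice \<Rightarrow> ('u, 'v) vgroup \<Rightarrow> ('u, 'v) varrow \<Rightarrow> bool" where
  "is_quot_arrow k X q \<longleftrightarrow> vdom q = X \<and>
     (\<exists>\<phi>\<in>viso (quot_vgroup k X) (vcod q). \<forall>x\<in>carrier X. vmap q x = \<phi> (quot_map k X x))"

end

theory Submission
  imports Defs
begin

text \<open>Call \<open>x\<close> and \<open>y\<close> equivalent if \<open>a(x,y) = a(y,x) = k\<close>. This is a group congruence with
  kernel \<open>N\<^sub>X\<close>, and \<open>a\<close> is constant on pairs of classes because \<open>k\<close> is both the unit and the top.
  Hence an arrow out of \<open>X\<close> factors through \<open>X/N\<^sub>X\<close> iff it kills \<open>N\<^sub>X\<close>, and an arrow into \<open>X\<close>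
  factors through \<open>N\<^sub>X\<close> iff its image lies in \<open>N\<^sub>X\<close>. As arrows map \<open>N\<^sub>X\<close> into \<open>N\<^sub>Y\<close>, which is
  trivial for separated \<open>Y\<close> and everything for indiscrete \<open>Y\<close>, the same two factorizations give the
  universal arrows of the adjunctions and exhibit \<open>\<eta>\<^sub>X\<close> and \<open>k\<^sub>X\<close> as cokernel and kernel of each
  other.\<close>

section \<open>Universal arrows\<close>

lemma homset_full_subcat:
  "f \<in> homset (full_subcat C P) A B \<longleftrightarrow> f \<in> homset C A B \<and> P A \<and> P B"
  by (auto simp: homset_def full_subcat_def)

lemma full_subcat_simps [simp]:
  "A \<in> Obj (full_subcat C P) \<longleftrightarrow> A \<in> Obj C \<and> P A"
  "f \<in> Arr (full_subcat C P) \<longleftrightarrow> f \<in> Arr C \<and> P (Dom C f) \<and> P (Cod C f)"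
  "Dom (full_subcat C P) = Dom C" "Cod (full_subcat C P) = Cod C"
  "Ident (full_subcat C P) = Ident C" "Comp (full_subcat C P) = Comp C"
  by (auto simp: full_subcat_def)

lemma incl_func_simps [simp]: "fobj incl_func A = A" "farr incl_func f = f"
  by (auto simp: incl_func_def)

lemma comp_func_simps [simp]:
  "fobj (comp_func G F) A = fobj G (fobj F A)" "farr (comp_func G F) f = farr G (farr F f)"
  by (auto simp: comp_func_def)

lemma homsetD:
  assumes "f \<in> homset C A B"
  shows "f \<in> Arr C" "Dom C f = A" "Cod C f = B"
  using assms by (auto simp: homset_def)

lemma is_functorI:
  assumes "is_category C" "is_category D"
    and "\<And>A. A \<in> Obj C \<Longrightarrow> fobj F A \<in> Obj D"
    and "\<And>f A B. f \<in> homset C A B \<Longrightarrow> farr F f \<in> homset D (fobj F A) (fobj F B)"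
    and "\<And>A. A \<in> Obj C \<Longrightarrow> farr F (Ident C A) = Ident D (fobj F A)"
    and "\<And>f g A B E. f \<in> homset C A B \<Longrightarrow> g \<in> homset C B E \<Longrightarrow>
      farr F (Comp C g f) = Comp D (farr F g) (farr F f)"
  shows "is_functor C D F"
  using assms unfolding is_functor_def homset_def by simp

lemma is_functor_comp:
  assumes F: "is_functor C D F" and G: "is_functor D E G"
  shows "is_functor C E (comp_func G F)"
proof (rule is_functorI)
  fix f g A B B' assume "f \<in> homset C A B" "g \<in> homset C B B'"
  then show "farr (comp_func G F) (Comp C g f) =
      Comp E (farr (comp_func G F) g) (farr (comp_func G F) f)"
    using F G unfolding is_functor_def homset_def by simp
qed (use F G in \<open>simp_all add: is_functor_def homset_def\<close>)

context
  fixes C :: "('o, 'm) cat"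
  assumes cat: "is_category C"
begin

lemma homset_Obj: "f \<in> homset C A B \<Longrightarrow> A \<in> Obj C \<and> B \<in> Obj C"
  using cat by (auto simp: is_category_def homset_def)

lemma Ident_homset: "A \<in> Obj C \<Longrightarrow> Ident C A \<in> homset C A A"
  using cat by (auto simp: is_category_def)

lemma Comp_homset:
  "f \<in> homset C A B \<Longrightarrow> g \<in> homset C B D \<Longrightarrow> Comp C g f \<in> homset C A D"
  using cat by (simp add: is_category_def homset_def)

lemma Comp_Ident:
  assumes "f \<in> homset C A B"
  shows "Comp C f (Ident C A) = f" "Comp C (Ident C B) f = f"
  using cat assms by (auto simp: is_category_def homset_def)

lemma Comp_assoc:
  "f \<in> homset C A B \<Longrightarrow> g \<in> homset C B D \<Longrightarrow> h \<in> homset C D E \<Longrightarrow>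
    Comp C h (Comp C g f) = Comp C (Comp C h g) f"
  using cat by (auto simp: is_category_def homset_def)

lemma is_category_full_subcat: "is_category (full_subcat C P)"
  using cat by (auto simp: is_category_def homset_def)

text \<open>Factoring \<open>\<eta> B\<close> after \<open>f\<close> through \<open>\<eta> A\<close>
  extends \<open>R0\<close> to arrows. All equations for functoriality, naturality of the counit and
  the first triangle identity compare two arrows out of some \<open>R0 A\<close> into an object
  satisfying \<open>P\<close>, so the uniqueness in \<open>univ\<close> reduces them to equations
  after composition with \<open>\<eta> A\<close>.\<close>

lemma reflection_if_universal_arrows:
  assumes R0: "\<And>A. A \<in> Obj C \<Longrightarrow> R0 A \<in> Obj C \<and> P (R0 A)"
    and eta: "\<And>A. A \<in> Obj C \<Longrightarrow> \<eta> A \<in> homset C A (R0 A)"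
    and univ: "\<And>A B f. f \<in> homset C A B \<Longrightarrow> P B \<Longrightarrow>
      \<exists>!u. u \<in> homset C (R0 A) B \<and> Comp C u (\<eta> A) = f"
  shows "\<exists>R. reflection C P R \<eta>"
proof -
  \<comment> \<open>The unique factor of \<open>f\<close> through \<open>\<eta> A\<close>;
    \<open>univ\<close> makes the description definite whenever \<open>P B\<close> holds.\<close>
  define ext where "ext A B f = (THE u. u \<in> homset C (R0 A) B \<and> Comp C u (\<eta> A) = f)" for A B f
  have ext: "ext A B f \<in> homset C (R0 A) B" "Comp C (ext A B f) (\<eta> A) = f"
    if "f \<in> homset C A B" "P B" for A B f
    using theI'[OF univ[OF that]] by (auto simp: ext_def)
  \<comment> \<open>Arrows into objects satisfying \<open>P\<close> can be cancelled against
    \<open>\<eta> A\<close> on the right; this is how every equation below is proved.\<close>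
  have ext_eq: "u = v" if "u \<in> homset C (R0 A) B" "v \<in> homset C (R0 A) B" "P B" "A \<in> Obj C"
    "Comp C u (\<eta> A) = Comp C v (\<eta> A)" for u v A B
    using univ[of "Comp C u (\<eta> A)" A B] Comp_homset[OF eta[OF that(4)] that(1)] that by metis
  \<comment> \<open>On arrows, \<open>R\<close> is forced: it must make the naturality square of
    \<eta> commute.\<close>
  define R where "R = \<lparr>fobj = R0, farr = (\<lambda>f. ext (Dom C f) (R0 (Cod C f)) (Comp C (\<eta> (Cod C f)) f))\<rparr>"
  have Rhom: "farr R f \<in> homset C (R0 A) (R0 B)"
    and Rnat: "Comp C (farr R f) (\<eta> A) = Comp C (\<eta> B) f" if f: "f \<in> homset C A B" for f A B
  proof -
    have B: "B \<in> Obj C" using homset_Obj[OF f] by simp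
    have "Comp C (\<eta> B) f \<in> homset C A (R0 B)" by (rule Comp_homset[OF f eta[OF B]])
    note * = ext[OF this conjunct2[OF R0[OF B]]]
    show "farr R f \<in> homset C (R0 A) (R0 B)" "Comp C (farr R f) (\<eta> A) = Comp C (\<eta> B) f"
      using * homsetD[OF f] by (simp_all add: R_def)
  qed
  have R_Ident: "farr R (Ident C A) = Ident C (R0 A)" if A: "A \<in> Obj C" for A
  proof (rule ext_eq[OF Rhom[OF Ident_homset[OF A]] Ident_homset _ A])
    show "Comp C (farr R (Ident C A)) (\<eta> A) = Comp C (Ident C (R0 A)) (\<eta> A)"
      using Rnat[OF Ident_homset[OF A]] Comp_Ident[OF eta[OF A]] by simp
  qed (use R0 A in auto)
  have R_Comp: "farr R (Comp C g f) = Comp C (farr R g) (farr R f)"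
    if f: "f \<in> homset C A B" and g: "g \<in> homset C B D" for f g A B D
  proof -
    have O: "A \<in> Obj C" "B \<in> Obj C" "D \<in> Obj C" using homset_Obj f g by auto
    note gf = Comp_homset[OF f g]
    have "Comp C (farr R (Comp C g f)) (\<eta> A) = Comp C (\<eta> D) (Comp C g f)" by (rule Rnat[OF gf])
    also have "\<dots> = Comp C (Comp C (farr R g) (\<eta> B)) f"
      using Comp_assoc[OF f g eta] Rnat[OF g] O by simp
    also have "\<dots> = Comp C (farr R g) (Comp C (farr R f) (\<eta> A))"
      using Comp_assoc[OF f eta Rhom[OF g]] Rnat[OF f] O by simp
    also have "\<dots> = Comp C (Comp C (farr R g) (farr R f)) (\<eta> A)"
      using Comp_assoc[OF eta Rhom[OF f] Rhom[OF g]] O by simp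
    finally show ?thesis
      using ext_eq[OF Rhom[OF gf] Comp_homset[OF Rhom[OF f] Rhom[OF g]]] R0 O by blast
  qed
  have R_obj: "fobj R A = R0 A" for A by (simp add: R_def)
  have homI: "f \<in> Arr C \<Longrightarrow> f \<in> homset C (Dom C f) (Cod C f)" for f
    by (simp add: homset_def)
  \<comment> \<open>The counit at \<open>B\<close> is the retraction of \<open>\<eta> B\<close>
    obtained by factoring the identity of \<open>B\<close>.\<close>
  define \<epsilon> where "\<epsilon> B = ext B B (Ident C B)" for B
  have eps: "\<epsilon> B \<in> homset C (R0 B) B" "Comp C (\<epsilon> B) (\<eta> B) = Ident C B"
    if "B \<in> Obj C" "P B" for B
    using ext[OF Ident_homset] that by (auto simp: \<epsilon>_def)
  let ?D = "full_subcat C P"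
  have catD: "is_category ?D" by (rule is_category_full_subcat)
  have FR: "is_functor C ?D R"
  proof (rule is_functorI[OF cat catD])
    show "farr R f \<in> homset ?D (fobj R A) (fobj R B)" if f: "f \<in> homset C A B" for f A B
      using Rhom[OF f] homset_Obj[OF f] R0 by (simp add: R_obj homset_full_subcat)
  qed (simp_all add: R_obj R_Ident R_Comp R0)
  have FI: "is_functor ?D C incl_func"
    by (rule is_functorI[OF catD cat]) (simp_all add: homset_full_subcat)
  have FIC: "is_functor C C incl_func"
    by (rule is_functorI[OF cat cat]) simp_all
  have FID: "is_functor ?D ?D incl_func"
    by (rule is_functorI[OF catD catD]) simp_all
  have FRI: "is_functor C C (comp_func incl_func R)"
    by (rule is_functor_comp[OF FR FI])
  have FIR: "is_functor ?D ?D (comp_func R incl_func)"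
    by (rule is_functor_comp[OF FI FR])
  have eps_nat: "Comp C (\<epsilon> B) (farr R f) = Comp C f (\<epsilon> A)"
    if f: "f \<in> homset C A B" and P: "P A" "P B" for f A B
  proof -
    have O: "A \<in> Obj C" "B \<in> Obj C" using homset_Obj f by auto
    have "Comp C (Comp C (\<epsilon> B) (farr R f)) (\<eta> A) = Comp C (\<epsilon> B) (Comp C (\<eta> B) f)"
      using Comp_assoc[OF eta Rhom[OF f] eps(1)] Rnat[OF f] O P by simp
    also have "\<dots> = f"
      using Comp_assoc[OF f eta eps(1)] Comp_Ident(2)[OF f] O P eps(2) by simp
    also have "\<dots> = Comp C (Comp C f (\<epsilon> A)) (\<eta> A)"
      using Comp_assoc[OF eta eps(1) f] Comp_Ident(1)[OF f] O P eps(2) by simp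
    finally show ?thesis
      using ext_eq[OF Comp_homset[OF Rhom[OF f] eps(1)] Comp_homset[OF eps(1) f]] O P by blast
  qed
  have triangle: "Comp C (\<epsilon> (R0 A)) (farr R (\<eta> A)) = Ident C (R0 A)" if A: "A \<in> Obj C" for A
  proof -
    have RA: "R0 A \<in> Obj C" "P (R0 A)" using R0 A by auto
    note e = eps(1)[OF RA] and h = eta[OF A]
    have "Comp C (Comp C (\<epsilon> (R0 A)) (farr R (\<eta> A))) (\<eta> A) =
        Comp C (\<epsilon> (R0 A)) (Comp C (\<eta> (R0 A)) (\<eta> A))"
      using Comp_assoc[OF h Rhom[OF h] e] Rnat[OF h] by simp
    also have "\<dots> = Comp C (Ident C (R0 A)) (\<eta> A)"
      using Comp_assoc[OF h eta[OF RA(1)] e] eps(2)[OF RA] by simp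
    finally show ?thesis
      using ext_eq[OF Comp_homset[OF Rhom[OF h] e] Ident_homset[OF RA(1)] RA(2) A] by blast
  qed
  \<comment> \<open>The second triangle identity is the defining equation \<open>eps(2)\<close> of
    the counit.\<close>
  have "adjunction C ?D R incl_func \<eta> \<epsilon>"
    unfolding adjunction_def nat_trans_def
    by (intro conjI FR FI FIC FID FRI FIR ballI)
      (simp_all add: R_obj homset_full_subcat eta eps R0 triangle Rnat[OF homI] eps_nat[OF homI])
  then show ?thesis unfolding reflection_def by blast
qed

end

section \<open>Duality\<close>

definition op_cat :: "('o, 'm) cat \<Rightarrow> ('o, 'm) cat" where
  "op_cat C = \<lparr>Obj = Obj C, Arr = Arr C, Dom = Cod C, Cod = Dom C, Ident = Ident C,
               Comp = (\<lambda>g f. Comp C f g)\<rparr>"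

lemma op_cat_simps [simp]:
  "Obj (op_cat C) = Obj C" "Arr (op_cat C) = Arr C" "Dom (op_cat C) = Cod C"
  "Cod (op_cat C) = Dom C" "Ident (op_cat C) = Ident C" "Comp (op_cat C) g f = Comp C f g"
  "homset (op_cat C) A B = homset C B A" "op_cat (op_cat C) = C"
  by (auto simp: op_cat_def homset_def)

lemma op_full_subcat: "full_subcat (op_cat C) P = op_cat (full_subcat C P)"
  by (auto simp: full_subcat_def op_cat_def)

lemma is_category_op: "is_category C \<Longrightarrow> is_category (op_cat C)"
  unfolding is_category_def by auto

lemma is_functor_op: "is_functor (op_cat C) (op_cat D) F \<Longrightarrow> is_functor C D F"
  using is_category_op[of "op_cat C"] is_category_op[of "op_cat D"]
  unfolding is_functor_def by auto

lemma nat_trans_op: "nat_trans (op_cat C) (op_cat D) F G \<tau> \<Longrightarrow> nat_trans C D G F \<tau>"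
  using is_functor_op[of C D] unfolding nat_trans_def by auto

text \<open>Passing to the opposite categories exchanges left and right adjoint, unit and counit,
  and the two triangle identities. Since \<open>P\<close> concerns objects only, the full
  subcategory of the opposite is the opposite of the full subcategory. Thus the construction of
  adjoints is carried out only once.\<close>

lemma coreflection_if_op_reflection:
  assumes "reflection (op_cat C) P R \<epsilon>"
  shows "coreflection C P R \<epsilon>"
proof -
  let ?D = "full_subcat C P"
  obtain \<eta> where adj: "adjunction (op_cat C) (op_cat ?D) R incl_func \<epsilon> \<eta>"
    using assms unfolding reflection_def op_full_subcat by blast
  have "adjunction ?D C incl_func R \<eta> \<epsilon>"
    unfolding adjunction_def
  proof (intro conjI)
    show "is_functor ?D C incl_func" "is_functor C ?D R"
      using adj is_functor_op unfolding adjunction_def by blast+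
    show "nat_trans ?D ?D incl_func (comp_func R incl_func) \<eta>"
      "nat_trans C C (comp_func incl_func R) incl_func \<epsilon>"
      using adj nat_trans_op unfolding adjunction_def by blast+
  qed (use adj in \<open>simp_all add: adjunction_def\<close>)
  then show ?thesis unfolding coreflection_def by blast
qed

lemma coreflection_if_universal_arrows:
  assumes cat: "is_category C"
    and R0: "\<And>A. A \<in> Obj C \<Longrightarrow> R0 A \<in> Obj C \<and> P (R0 A)"
    and eps: "\<And>A. A \<in> Obj C \<Longrightarrow> \<epsilon> A \<in> homset C (R0 A) A"
    and univ: "\<And>A B f. f \<in> homset C B A \<Longrightarrow> P B \<Longrightarrow>
      \<exists>!u. u \<in> homset C B (R0 A) \<and> Comp C (\<epsilon> A) u = f"
  shows "\<exists>R. coreflection C P R \<epsilon>"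
proof -
  have "\<exists>R. reflection (op_cat C) P R \<epsilon>"
    by (rule reflection_if_universal_arrows[OF is_category_op[OF cat], of R0])
      (simp_all add: R0 eps univ)
  then show ?thesis using coreflection_if_op_reflection by blast
qed

section \<open>Groups over an integral quantale\<close>

locale integral_quantale = comm_unital_quantale tensor k
  for tensor :: "'v::complete_lattice \<Rightarrow> 'v \<Rightarrow> 'v" and k :: 'v +
  assumes integral: "k = Orderings.top"
begin

lemma le_k [simp]: "v \<le> k"
  by (simp add: integral)

lemma k_le_iff: "k \<le> v \<longleftrightarrow> v = k"
  by (auto intro: antisym)

lemma tensor_unit_right: "tensor v k = v"
  by (metis tensor_comm tensor_unit)

text \<open>Membership in the carrier is built in, so that the class of \<open>x\<close> in the
  carrier, as a subset of the whole type, is exactly the coset of \<open>x\<close>.\<close>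

definition veq :: "('u, 'v) vgroup \<Rightarrow> 'u \<Rightarrow> 'u \<Rightarrow> bool" where
  "veq X x y \<longleftrightarrow> x \<in> carrier X \<and> y \<in> carrier X \<and> vrel X x y = k \<and> vrel X y x = k"

text \<open>The choice depends on the coset and not on the element, so elements of one coset receive
  the same representative.\<close>

definition rep :: "('u, 'v) vgroup \<Rightarrow> 'u \<Rightarrow> 'u" where
  "rep X x = (SOME y. y \<in> quot_map k X x)"

text \<open>A copy of \<open>X/N\<^sub>X\<close> on a set of representatives, so that its carrier stays in the type
  \<open>'u\<close>.\<close>

definition quot_rep :: "('u, 'v) vgroup \<Rightarrow> ('u, 'v) vgroup" where
  "quot_rep X = \<lparr>carrier = rep X ` carrier X, mult = (\<lambda>x y. rep X (x \<otimes>\<^bsub>X\<^esub> y)),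
                 one = rep X \<one>\<^bsub>X\<^esub>, vrel = vrel X\<rparr>"

definition quot_arrow :: "('u, 'v) vgroup \<Rightarrow> ('u, 'v) varrow" where
  "quot_arrow X = VArrow X (quot_rep X) (\<lambda>x\<in>carrier X. rep X x)"

lemma quot_rep_simps [simp]:
  "carrier (quot_rep X) = rep X ` carrier X" "x \<otimes>\<^bsub>quot_rep X\<^esub> y = rep X (x \<otimes>\<^bsub>X\<^esub> y)"
  "\<one>\<^bsub>quot_rep X\<^esub> = rep X \<one>\<^bsub>X\<^esub>" "vrel (quot_rep X) = vrel X"
  by (auto simp: quot_rep_def)

lemma Nobj_simps [simp]:
  "carrier (Nobj k X) = Nset k X" "x \<otimes>\<^bsub>Nobj k X\<^esub> y = x \<otimes>\<^bsub>X\<^esub> y"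
  "\<one>\<^bsub>Nobj k X\<^esub> = \<one>\<^bsub>X\<^esub>" "vrel (Nobj k X) = vrel X"
  by (auto simp: Nobj_def)

lemma separatedD: "separated k X \<Longrightarrow> veq X x y \<Longrightarrow> x = y"
  unfolding separated_def veq_def by (metis order_refl)

section \<open>The group congruence with kernel N_X\<close>

context
  fixes X :: "('u, 'v) vgroup"
  assumes X: "is_vgroup tensor k X"
begin

interpretation group X
  using X by (simp add: is_vgroup_def)

lemma vrel_refl: "x \<in> carrier X \<Longrightarrow> vrel X x x = k"
  using X by (simp add: is_vgroup_def is_vcategory_def k_le_iff)

lemma vrel_trans:
  "x \<in> carrier X \<Longrightarrow> y \<in> carrier X \<Longrightarrow> z \<in> carrier X \<Longrightarrow>
    tensor (vrel X x y) (vrel X y z) \<le> vrel X x z"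
  using X by (simp add: is_vgroup_def is_vcategory_def)

lemma vrel_mult:
  "x1 \<in> carrier X \<Longrightarrow> x2 \<in> carrier X \<Longrightarrow> y1 \<in> carrier X \<Longrightarrow> y2 \<in> carrier X \<Longrightarrow>
    tensor (vrel X x1 x2) (vrel X y1 y2) \<le> vrel X (x1 \<otimes>\<^bsub>X\<^esub> y1) (x2 \<otimes>\<^bsub>X\<^esub> y2)"
  using X by (simp add: is_vgroup_def)

lemma veq_carrier: "veq X x y \<Longrightarrow> x \<in> carrier X" "veq X x y \<Longrightarrow> y \<in> carrier X"
  by (auto simp: veq_def)

lemma veq_refl: "x \<in> carrier X \<Longrightarrow> veq X x x"
  by (simp add: veq_def vrel_refl)

lemma veq_sym: "veq X x y \<Longrightarrow> veq X y x"
  by (simp add: veq_def)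

text \<open>As k is the unit, transitivity gives a(x,y) = a(x',x) \<otimes> a(x,y) \<le> a(x',y),
  and likewise in the second argument. Equality follows because the hypotheses are symmetric. This
  makes the supremum in the quotient structure a supremum of a single value.\<close>

lemma vrel_veq:
  assumes "veq X x x'" "veq X y y'"
  shows "vrel X x y = vrel X x' y'"
proof -
  have le: "vrel X x y \<le> vrel X x' y'" if "veq X x x'" "veq X y y'" for x x' y y'
  proof -
    have "vrel X x y \<le> vrel X x' y"
      using vrel_trans[of x' x y] that by (simp add: veq_def tensor_unit)
    also have "\<dots> \<le> vrel X x' y'"
      using vrel_trans[of x' y y'] that by (simp add: veq_def tensor_unit_right)
    finally show ?thesis .
  qed
  show ?thesis
    using le[OF assms] le[OF assms[THEN veq_sym]] by (rule antisym)
qed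

lemma veq_trans: "veq X x y \<Longrightarrow> veq X y z \<Longrightarrow> veq X x z"
  using vrel_veq[of x y z z] vrel_veq[of z z x y] veq_refl[of z]
  by (simp add: veq_def)

text \<open>The compatibility of a with the group operation is applied to k \<otimes> k = k in both
  directions.\<close>

lemma veq_mult:
  assumes "veq X x x'" "veq X y y'"
  shows "veq X (x \<otimes>\<^bsub>X\<^esub> y) (x' \<otimes>\<^bsub>X\<^esub> y')"
  using assms vrel_mult[of x x' y y'] vrel_mult[of x' x y' y]
  by (simp add: veq_def tensor_unit k_le_iff)

lemma mem_Nset: "x \<in> Nset k X \<longleftrightarrow> veq X \<one>\<^bsub>X\<^esub> x"
  by (auto simp: Nset_def veq_def k_le_iff)

text \<open>Multiplication on the right by the inverse of x, or back by x, preserves equivalence.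
  Hence the equivalence classes are the right cosets of N_X.\<close>

lemma veq_iff_Nset:
  assumes x: "x \<in> carrier X" and y: "y \<in> carrier X"
  shows "veq X x y \<longleftrightarrow> y \<otimes>\<^bsub>X\<^esub> inv\<^bsub>X\<^esub> x \<in> Nset k X"
proof
  assume "veq X x y"
  from veq_mult[OF this veq_refl[of "inv\<^bsub>X\<^esub> x"]] show "y \<otimes>\<^bsub>X\<^esub> inv\<^bsub>X\<^esub> x \<in> Nset k X"
    using x by (simp add: mem_Nset)
next
  assume "y \<otimes>\<^bsub>X\<^esub> inv\<^bsub>X\<^esub> x \<in> Nset k X"
  from veq_mult[OF this[unfolded mem_Nset] veq_refl[OF x]] show "veq X x y"
    using x y by (simp add: m_assoc)
qed

lemma Nset_normal: "Nset k X \<lhd> X"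
proof -
  \<comment> \<open>The inverse of x is 1 times the inverse of x, so its membership says that x is
    equivalent to 1.\<close>
  have inv: "inv\<^bsub>X\<^esub> x \<in> Nset k X" if "x \<in> Nset k X" for x
    using veq_iff_Nset[of x "\<one>\<^bsub>X\<^esub>"] veq_sym that by (auto simp: mem_Nset veq_def)
  have "subgroup (Nset k X) X"
  proof (rule subgroupI)
    show "Nset k X \<noteq> {}" using veq_refl[of "\<one>\<^bsub>X\<^esub>"] mem_Nset by auto
    show "a \<otimes>\<^bsub>X\<^esub> b \<in> Nset k X" if "a \<in> Nset k X" "b \<in> Nset k X" for a b
      using veq_mult[of "\<one>\<^bsub>X\<^esub>" a "\<one>\<^bsub>X\<^esub>" b] that by (simp add: mem_Nset)
  qed (auto simp: inv, auto simp: Nset_def)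
  \<comment> \<open>Conjugation by x fixes 1, so a conjugate of an element equivalent to 1 is again
    equivalent to 1.\<close>
  moreover have "x \<otimes>\<^bsub>X\<^esub> h \<otimes>\<^bsub>X\<^esub> inv\<^bsub>X\<^esub> x \<in> Nset k X" if "x \<in> carrier X" "h \<in> Nset k X" for x h
    using veq_mult[OF veq_mult[OF veq_refl] veq_refl, of x "\<one>\<^bsub>X\<^esub>" h "inv\<^bsub>X\<^esub> x"] that
    by (simp add: mem_Nset)
  ultimately show ?thesis unfolding normal_inv_iff by blast
qed

lemma quot_map_eq:
  assumes x: "x \<in> carrier X"
  shows "quot_map k X x = {y. veq X x y}"
proof (intro equalityI subsetI CollectI)
  fix y assume "y \<in> quot_map k X x"
  then obtain n where n: "n \<in> Nset k X" "y = n \<otimes>\<^bsub>X\<^esub> x"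
    by (auto simp: quot_map_def r_coset_def)
  then show "veq X x y"
    using veq_mult[OF _ veq_refl[OF x], of "\<one>\<^bsub>X\<^esub>" n] x by (simp add: mem_Nset)
next
  fix y assume "y \<in> {y. veq X x y}"
  then have y: "veq X x y" "y \<in> carrier X" using veq_carrier by auto
  have "y = (y \<otimes>\<^bsub>X\<^esub> inv\<^bsub>X\<^esub> x) \<otimes>\<^bsub>X\<^esub> x" using x y by (simp add: m_assoc)
  then show "y \<in> quot_map k X x"
    using veq_iff_Nset[OF x y(2)] y(1) by (auto simp: quot_map_def r_coset_def)
qed

lemma quot_map_eq_iff:
  "x \<in> carrier X \<Longrightarrow> y \<in> carrier X \<Longrightarrow> quot_map k X x = quot_map k X y \<longleftrightarrow> veq X x y"
  unfolding quot_map_eq set_eq_iff mem_Collect_eq using veq_refl veq_sym veq_trans by blast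

lemma veq_rep: "x \<in> carrier X \<Longrightarrow> veq X x (rep X x)"
  using someI[of "veq X x" x] veq_refl by (simp add: rep_def quot_map_eq)

lemma rep_carrier [simp]: "x \<in> carrier X \<Longrightarrow> rep X x \<in> carrier X"
  using veq_rep veq_carrier by blast

lemma rep_eq_iff:
  assumes "x \<in> carrier X" "y \<in> carrier X"
  shows "rep X x = rep X y \<longleftrightarrow> veq X x y"
proof
  assume "rep X x = rep X y"
  then show "veq X x y" using veq_rep[of x] veq_rep[of y] veq_sym veq_trans assms by metis
next
  assume "veq X x y"
  then show "rep X x = rep X y" using quot_map_eq_iff[OF assms] by (simp add: rep_def)
qed

lemma rep_mult_rep:
  assumes "x \<in> carrier X" "y \<in> carrier X"
  shows "rep X (rep X x \<otimes>\<^bsub>X\<^esub> rep X y) = rep X (x \<otimes>\<^bsub>X\<^esub> y)"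
  using assms veq_mult[OF veq_rep veq_rep] veq_sym by (simp add: rep_eq_iff)

lemma vrel_rep: "x \<in> carrier X \<Longrightarrow> y \<in> carrier X \<Longrightarrow> vrel X (rep X x) (rep X y) = vrel X x y"
  using vrel_veq[OF veq_rep veq_rep] by simp

section \<open>The quotient on representatives and the subobject N_X\<close>

lemma is_vgroup_quot_rep: "is_vgroup tensor k (quot_rep X)"
proof -
  \<comment> \<open>Inside an outer \<open>rep\<close>, inner occurrences of \<open>rep\<close> may
    be dropped; the group laws then reduce to those of \<open>X\<close>.\<close>
  have rep_mult: "rep X (rep X x \<otimes>\<^bsub>X\<^esub> y) = rep X (x \<otimes>\<^bsub>X\<^esub> y)" "rep X (y \<otimes>\<^bsub>X\<^esub> rep X x) = rep X (y \<otimes>\<^bsub>X\<^esub> x)"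
    if "x \<in> carrier X" "y \<in> carrier X" for x y
    using that veq_mult[OF veq_rep veq_refl] veq_mult[OF veq_refl veq_rep] veq_sym
    by (simp_all add: rep_eq_iff)
  have "group (quot_rep X)"
  proof (rule groupI)
    fix x assume "x \<in> carrier (quot_rep X)"
    then obtain a where a: "a \<in> carrier X" "x = rep X a" by auto
    show "\<exists>y\<in>carrier (quot_rep X). y \<otimes>\<^bsub>quot_rep X\<^esub> x = \<one>\<^bsub>quot_rep X\<^esub>"
      by (rule bexI[of _ "rep X (inv\<^bsub>X\<^esub> a)"]) (use a in \<open>auto simp: rep_mult\<close>)
  qed (auto simp: rep_mult m_assoc)
  moreover have "is_vcategory tensor k (carrier (quot_rep X)) (vrel (quot_rep X))"
    using vrel_refl vrel_trans by (auto simp: is_vcategory_def)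
  moreover have "tensor (vrel X x1 x2) (vrel X y1 y2) \<le> vrel X (rep X (x1 \<otimes>\<^bsub>X\<^esub> y1)) (rep X (x2 \<otimes>\<^bsub>X\<^esub> y2))"
    if "x1 \<in> carrier X" "x2 \<in> carrier X" "y1 \<in> carrier X" "y2 \<in> carrier X" for x1 x2 y1 y2
    using vrel_mult[OF that] that by (simp add: vrel_rep)
  ultimately show ?thesis
    by (auto simp: is_vgroup_def)
qed

text \<open>Equivalent representatives come from one coset, and \<open>rep\<close> is constant on
  cosets.\<close>

lemma separated_quot_rep: "separated k (quot_rep X)"
  unfolding separated_def
  by (auto simp: vrel_rep k_le_iff rep_eq_iff veq_def)

lemma Nset_subset: "Nset k X \<subseteq> carrier X"
  by (auto simp: Nset_def)

text \<open>Applied to N_X, and to the trivial subgroup in order to obtain a zero object.\<close>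

lemma is_vgroup_subgroup:
  assumes H: "subgroup H X"
  shows "is_vgroup tensor k (X\<lparr>carrier := H\<rparr>)"
proof -
  note sub = subgroup.mem_carrier[OF H]
  have "group (X\<lparr>carrier := H\<rparr>)" by (rule subgroup.subgroup_is_group[OF H is_group])
  then show ?thesis
    using vrel_refl vrel_trans vrel_mult sub
    by (auto simp: is_vgroup_def is_vcategory_def)
qed

lemma is_vgroup_Nobj: "is_vgroup tensor k (Nobj k X)"
  unfolding Nobj_def by (rule is_vgroup_subgroup[OF normal_imp_subgroup[OF Nset_normal]])

text \<open>Any two elements of N_X are equivalent through 1, and k is the top element.\<close>

lemma indiscrete_Nobj: "indiscrete (Nobj k X)"
  unfolding indiscrete_def
proof (intro ballI)
  fix x y assume "x \<in> carrier (Nobj k X)" "y \<in> carrier (Nobj k X)"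
  then have "veq X x y" using veq_trans veq_sym by (metis Nobj_simps(1) mem_Nset)
  then show "vrel (Nobj k X) x y = Orderings.top" by (simp add: veq_def flip: integral)
qed

text \<open>Sending a coset to its representative is an isomorphism onto \<open>quot_rep X\<close>:
  it is bijective, respects products, and preserves the relation with equality in both
  directions.\<close>

lemma is_quot_arrow_quot_arrow: "is_quot_arrow k X (quot_arrow X)"
proof -
  \<comment> \<open>This is the very choice used in \<open>rep\<close>, so that
    \<open>\<phi>\<close> after the quotient map is \<open>rep\<close> by definition.\<close>
  define \<phi> where "\<phi> z = (SOME y. y \<in> z)" for z :: "'u set"
  let ?Q = "quot_vgroup k X"
  have \<phi>: "\<phi> (quot_map k X x) = rep X x" for x
    by (simp add: \<phi>_def rep_def)
  have carrier: "carrier ?Q = quot_map k X ` carrier X"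
    by (auto simp: quot_vgroup_def FactGroup_def RCOSETS_def quot_map_def)
  have mult: "quot_map k X x \<otimes>\<^bsub>?Q\<^esub> quot_map k X y = quot_map k X (x \<otimes>\<^bsub>X\<^esub> y)"
    if "x \<in> carrier X" "y \<in> carrier X" for x y
    using normal.rcos_sum[OF Nset_normal that]
    by (simp add: quot_vgroup_def FactGroup_def quot_map_def)
  have vrel: "vrel ?Q (quot_map k X x) (quot_map k X y) = vrel X x y"
    if "x \<in> carrier X" "y \<in> carrier X" for x y
  proof -
    \<comment> \<open>The supremum ranges over all pairs of elements of the two cosets, where a
      takes only one value.\<close>
    have "{vrel X x1 x2 |x1 x2. x1 \<in> carrier X \<and> x2 \<in> carrier X \<and>
            quot_map k X x1 = quot_map k X x \<and> quot_map k X x2 = quot_map k X y} = {vrel X x y}"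
      using that by (auto simp: quot_map_eq_iff intro: vrel_veq)
    then show ?thesis by (simp add: quot_vgroup_def)
  qed
  have inj: "inj_on \<phi> (carrier ?Q)"
    by (auto simp: inj_on_def carrier \<phi> rep_eq_iff quot_map_eq_iff)
  then have bij: "bij_betw \<phi> (carrier ?Q) (carrier (quot_rep X))"
    by (simp add: bij_betw_def carrier image_image \<phi>)
  have inv: "inv_into (carrier ?Q) \<phi> (rep X x) = quot_map k X x" if "x \<in> carrier X" for x
    using inv_into_f_f[OF inj, of "quot_map k X x"] that by (simp add: carrier \<phi>)
  have "\<phi> \<in> vhom ?Q (quot_rep X)"
    unfolding vhom_def hom_def
    by (auto simp: carrier \<phi> mult vrel vrel_rep rep_mult_rep)
  moreover have "inv_into (carrier ?Q) \<phi> \<in> vhom (quot_rep X) ?Q"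
    unfolding vhom_def hom_def
    by (auto simp: inv[unfolded carrier] mult vrel vrel_rep rep_mult_rep carrier)
  ultimately have "\<phi> \<in> viso ?Q (quot_rep X)" using bij by (simp add: viso_def)
  then show ?thesis
    unfolding is_quot_arrow_def quot_arrow_def by (auto simp: \<phi> intro!: bexI[of _ \<phi>])
qed

end

section \<open>The category of V-groups\<close>

lemma homset_VGrp:
  "f \<in> homset (VGrp tensor k) X Y \<longleftrightarrow> is_vgroup tensor k X \<and> is_vgroup tensor k Y \<and>
    vdom f = X \<and> vcod f = Y \<and> vmap f \<in> vhom X Y \<and> vmap f \<in> extensional (carrier X)"
  by (auto simp: homset_def VGrp_def)

lemma Obj_VGrp [simp]: "X \<in> Obj (VGrp tensor k) \<longleftrightarrow> is_vgroup tensor k X"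
  by (simp add: VGrp_def)

lemma VGrp_arrow_eqI:
  assumes "f \<in> homset (VGrp tensor k) X Y" "g \<in> homset (VGrp tensor k) X Y"
    and "\<And>x. x \<in> carrier X \<Longrightarrow> vmap f x = vmap g x"
  shows "f = g"
  using assms by (auto simp: homset_VGrp intro!: varrow.expand extensionalityI)

lemma vhomD:
  assumes "f \<in> vhom X Y" "x \<in> carrier X" "y \<in> carrier X"
  shows "f x \<in> carrier Y" "f (x \<otimes>\<^bsub>X\<^esub> y) = f x \<otimes>\<^bsub>Y\<^esub> f y" "vrel X x y \<le> vrel Y (f x) (f y)"
  using assms by (auto simp: vhom_def hom_def)

lemma vmap_VGrp_Comp:
  assumes "f \<in> homset (VGrp tensor k) X Y" "x \<in> carrier X"
  shows "vmap (Comp (VGrp tensor k) g f) x = vmap g (vmap f x)"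
  using assms by (simp add: VGrp_def homset_def compose_eq)

lemma VGrp_Comp_homset:
  assumes f: "f \<in> homset (VGrp tensor k) X Y" and g: "g \<in> homset (VGrp tensor k) Y Z"
  shows "Comp (VGrp tensor k) g f \<in> homset (VGrp tensor k) X Z"
proof -
  from f g have grp: "group X" "group Y" "group Z"
    by (auto simp: homset_VGrp is_vgroup_def)
  from f g have "compose (carrier X) (vmap g) (vmap f) \<in> hom X Z"
    using group.hom_compose[OF grp(1)]
    by (auto simp: homset_VGrp vhom_def hom_def compose_def monoid.m_closed[OF group.is_monoid[OF grp(1)]] Pi_iff)
  moreover have "vrel X x x'
      \<le> vrel Z (compose (carrier X) (vmap g) (vmap f) x) (compose (carrier X) (vmap g) (vmap f) x')"
    if "x \<in> carrier X" "x' \<in> carrier X" for x x'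
    using that f g vhomD(1)[of "vmap f" X Y x x'] vhomD(1)[of "vmap f" X Y x' x]
      vhomD(3)[of "vmap f" X Y x x'] vhomD(3)[of "vmap g" Y Z "vmap f x" "vmap f x'"]
    by (auto simp: homset_VGrp compose_eq intro: order_trans)
  ultimately show ?thesis
    using f g by (simp add: homset_VGrp vhom_def) (simp add: VGrp_def)
qed

lemma VGrp_Ident_homset:
  assumes "is_vgroup tensor k X"
  shows "Ident (VGrp tensor k) X \<in> homset (VGrp tensor k) X X"
  using assms group.is_monoid[of X] monoid.m_closed[of X]
  by (auto simp: homset_VGrp vhom_def hom_def is_vgroup_def) (auto simp: VGrp_def)

lemma is_category_VGrp:
  "is_category (VGrp tensor k :: (('u, 'v) vgroup, ('u, 'v) varrow) cat)" (is "is_category ?V")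
proof -
  have homI: "f \<in> homset ?V (Dom ?V f) (Cod ?V f)" if "f \<in> Arr ?V" for f
    using that by (simp add: homset_def)
  have vmap_Ident: "vmap (Ident ?V X) x = x" if "x \<in> carrier X" for X x
    using that by (simp add: VGrp_def)
  have in_carrier: "vmap f x \<in> carrier Y" if "f \<in> homset ?V X Y" "x \<in> carrier X" for f X Y x
    using that vhomD(1)[of "vmap f" X Y x x] by (auto simp: homset_VGrp)
  have unit: "Comp ?V f (Ident ?V X) = f" "Comp ?V (Ident ?V Y) f = f"
    if f: "f \<in> homset ?V X Y" for f X Y
  proof -
    have id: "Ident ?V X \<in> homset ?V X X" "Ident ?V Y \<in> homset ?V Y Y"
      using f VGrp_Ident_homset by (auto simp: homset_VGrp)
    show "Comp ?V f (Ident ?V X) = f"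
      by (rule VGrp_arrow_eqI[OF VGrp_Comp_homset[OF id(1) f] f])
        (simp add: vmap_VGrp_Comp[OF id(1)] vmap_Ident)
    show "Comp ?V (Ident ?V Y) f = f"
      by (rule VGrp_arrow_eqI[OF VGrp_Comp_homset[OF f id(2)] f])
        (simp add: vmap_VGrp_Comp[OF f] vmap_Ident in_carrier[OF f])
  qed
  have assoc: "Comp ?V h (Comp ?V g f) = Comp ?V (Comp ?V h g) f"
    if f: "f \<in> homset ?V A B" and g: "g \<in> homset ?V B C" and h: "h \<in> homset ?V C D"
    for f g h A B C D
    by (rule VGrp_arrow_eqI[OF VGrp_Comp_homset[OF VGrp_Comp_homset[OF f g] h]
          VGrp_Comp_homset[OF f VGrp_Comp_homset[OF g h]]])
      (simp add: vmap_VGrp_Comp[OF VGrp_Comp_homset[OF f g]] vmap_VGrp_Comp[OF f]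
        vmap_VGrp_Comp[OF g] in_carrier[OF f])
  show ?thesis
    unfolding is_category_def
  proof (intro conjI ballI impI)
    fix f assume "f \<in> Arr ?V"
    note f = homI[OF this]
    show "Dom ?V f \<in> Obj ?V" "Cod ?V f \<in> Obj ?V" using f by (auto simp: homset_VGrp)
    show "Comp ?V f (Ident ?V (Dom ?V f)) = f" "Comp ?V (Ident ?V (Cod ?V f)) f = f"
      using unit[OF f] by auto
  next
    fix f g assume "f \<in> Arr ?V" "g \<in> Arr ?V" "Cod ?V f = Dom ?V g"
    then show "Comp ?V g f \<in> homset ?V (Dom ?V f) (Cod ?V g)"
      using VGrp_Comp_homset[OF homI, of f g] homI[of g] by simp
  next
    fix f g h
    assume "f \<in> Arr ?V" "g \<in> Arr ?V" "h \<in> Arr ?V" "Cod ?V f = Dom ?V g \<and> Cod ?V g = Dom ?V h"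
    then show "Comp ?V h (Comp ?V g f) = Comp ?V (Comp ?V h g) f"
      using assoc[OF homI, of f g _ h] homI[of g] homI[of h] by simp
  qed (simp add: VGrp_Ident_homset)
qed

section \<open>Zero objects and zero arrows\<close>

lemma vhom_one:
  assumes "is_vgroup tensor k X" "is_vgroup tensor k Y" "f \<in> vhom X Y"
  shows "f \<one>\<^bsub>X\<^esub> = \<one>\<^bsub>Y\<^esub>"
  using assms by (auto simp: is_vgroup_def vhom_def intro: hom_one)

text \<open>Integrality makes the constant map a V-homomorphism: its pairs of values have relation
  k, which lies above everything.\<close>

lemma const_one_homset:
  assumes X: "is_vgroup tensor k X" and Y: "is_vgroup tensor k Y"
  shows "VArrow X Y (\<lambda>x\<in>carrier X. \<one>\<^bsub>Y\<^esub>) \<in> homset (VGrp tensor k) X Y"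
proof -
  interpret X: group X using X by (simp add: is_vgroup_def)
  interpret Y: group Y using Y by (simp add: is_vgroup_def)
  show ?thesis using X Y by (auto simp: homset_VGrp vhom_def hom_def vrel_refl)
qed

lemma zero_arr_VGrp_iff:
  fixes f :: "('u, 'v) varrow"
  assumes f: "f \<in> homset (VGrp tensor k) X Y"
  shows "zero_arr (VGrp tensor k) f \<longleftrightarrow> (\<forall>x\<in>carrier X. vmap f x = \<one>\<^bsub>Y\<^esub>)"
    (is "?L \<longleftrightarrow> ?R")
proof
  let ?V = "VGrp tensor k :: (('u, 'v) vgroup, ('u, 'v) varrow) cat"
  have X: "is_vgroup tensor k X" and Y: "is_vgroup tensor k Y"
    using f by (auto simp: homset_VGrp)
  assume ?L
  then obtain Z g h where Z: "zero_obj ?V Z" and g: "g \<in> homset ?V X Z"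
    and h: "h \<in> homset ?V Z Y" and fgh: "f = Comp ?V h g"
    using homsetD[OF f] unfolding zero_arr_def by auto
  have vZ: "is_vgroup tensor k Z" and "\<exists>!p. p \<in> homset ?V X Z"
    using Z X by (simp_all add: zero_obj_def)
  \<comment> \<open>The constant map is also an arrow into the zero object, hence equal to
    \<open>g\<close>.\<close>
  then have "g = VArrow X Z (\<lambda>x\<in>carrier X. \<one>\<^bsub>Z\<^esub>)"
    using g const_one_homset[OF X vZ] by (elim ex1E) metis
  then have "vmap g x = \<one>\<^bsub>Z\<^esub>" if "x \<in> carrier X" for x
    using that by simp
  then show ?R
    using vhom_one[OF vZ Y] h by (simp add: fgh vmap_VGrp_Comp[OF g] homset_VGrp)
next
  let ?V = "VGrp tensor k :: (('u, 'v) vgroup, ('u, 'v) varrow) cat"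
  assume R: ?R
  have X: "is_vgroup tensor k X" and Y: "is_vgroup tensor k Y"
    using f by (auto simp: homset_VGrp)
  interpret Y: group Y using Y by (simp add: is_vgroup_def)
  \<comment> \<open>The zero object must have its carrier in the type \<open>'u\<close>; the trivial
    subgroup of \<open>Y\<close> provides one.\<close>
  define Z where "Z = Y\<lparr>carrier := {\<one>\<^bsub>Y\<^esub>}\<rparr>"
  have Z: "is_vgroup tensor k Z"
    unfolding Z_def by (rule is_vgroup_subgroup[OF Y Y.triv_subgroup])
  have carrier_Z: "carrier Z = {\<one>\<^bsub>Y\<^esub>}" and one_Z: "\<one>\<^bsub>Z\<^esub> = \<one>\<^bsub>Y\<^esub>" by (auto simp: Z_def)
  have to_Z: "p = q" if p: "p \<in> homset ?V A Z" and q: "q \<in> homset ?V A Z" for p q A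
  proof (rule VGrp_arrow_eqI[OF p q])
    fix x assume "x \<in> carrier A"
    then show "vmap p x = vmap q x"
      using p q vhomD(1)[of "vmap p" A Z x x] vhomD(1)[of "vmap q" A Z x x]
      by (auto simp: homset_VGrp carrier_Z)
  qed
  have from_Z: "p = q" if p: "p \<in> homset ?V Z A" and q: "q \<in> homset ?V Z A" for p q A
  proof (rule VGrp_arrow_eqI[OF p q])
    fix x assume "x \<in> carrier Z"
    then show "vmap p x = vmap q x"
      using p q vhom_one[of Z A "vmap p"] vhom_one[of Z A "vmap q"]
      by (auto simp: homset_VGrp carrier_Z one_Z)
  qed
  note XZ = const_one_homset[OF X Z] and ZY = const_one_homset[OF Z Y]
  have "zero_obj ?V Z"
    unfolding zero_obj_def Obj_VGrp
  proof (intro conjI ballI)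
    fix A :: "('u, 'v) vgroup" assume "A \<in> Obj ?V"
    then have A: "is_vgroup tensor k A" by simp
    show "\<exists>!p. p \<in> homset ?V A Z"
      by (rule ex1I, rule const_one_homset[OF A Z], rule to_Z[OF _ const_one_homset[OF A Z]])
    show "\<exists>!p. p \<in> homset ?V Z A"
      by (rule ex1I, rule const_one_homset[OF Z A], rule from_Z[OF _ const_one_homset[OF Z A]])
  qed (rule Z)
  moreover have "f = Comp ?V (VArrow Z Y (\<lambda>x\<in>carrier Z. \<one>\<^bsub>Y\<^esub>)) (VArrow X Z (\<lambda>x\<in>carrier X. \<one>\<^bsub>Z\<^esub>))"
    by (rule VGrp_arrow_eqI[OF f VGrp_Comp_homset[OF XZ ZY]])
      (simp add: vmap_VGrp_Comp[OF XZ], simp add: R carrier_Z one_Z)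
  ultimately show ?L
    unfolding zero_arr_def homsetD(2,3)[OF f] using homsetD(1)[OF f] XZ ZY by blast
qed

section \<open>Factorization through the quotient and through N_X\<close>

lemma quot_arrow_homset:
  assumes X: "is_vgroup tensor k X"
  shows "quot_arrow X \<in> homset (VGrp tensor k) X (quot_rep X)"
proof -
  interpret group X using X by (simp add: is_vgroup_def)
  show ?thesis
    using X is_vgroup_quot_rep[OF X]
    by (auto simp: homset_VGrp quot_arrow_def vhom_def hom_def vrel_rep[OF X] rep_mult_rep[OF X])
qed

lemma Nincl_homset:
  assumes X: "is_vgroup tensor k X"
  shows "Nincl k X \<in> homset (VGrp tensor k) (Nobj k X) X"
proof -
  interpret N: subgroup "Nset k X" X by (rule normal_imp_subgroup[OF Nset_normal[OF X]])
  show ?thesis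
    using X is_vgroup_Nobj[OF X]
    by (auto simp: homset_VGrp Nincl_def vhom_def hom_def)
qed

text \<open>An arrow that kills N_X is constant on classes, so its restriction to the
  representatives is the factor. The hypothesis is on \<open>h\<close> rather than on
  \<open>Y\<close>, so that the lemma serves both the reflection and the cokernel.\<close>

lemma quot_arrow_universal:
  assumes h: "h \<in> homset (VGrp tensor k) X Y"
    and N: "\<And>n. n \<in> Nset k X \<Longrightarrow> vmap h n = \<one>\<^bsub>Y\<^esub>"
  shows "\<exists>!u. u \<in> homset (VGrp tensor k) (quot_rep X) Y \<and> Comp (VGrp tensor k) u (quot_arrow X) = h"
proof -
  let ?V = "VGrp tensor k"
  have X: "is_vgroup tensor k X" and Y: "is_vgroup tensor k Y" and hh: "vmap h \<in> vhom X Y"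
    using h by (auto simp: homset_VGrp)
  interpret X: group X using X by (simp add: is_vgroup_def)
  interpret Y: group Y using Y by (simp add: is_vgroup_def)
  note q = quot_arrow_homset[OF X]
  \<comment> \<open>If y is equivalent to x, then y is x multiplied on the left by an element of
    N_X, which \<open>h\<close> sends to 1.\<close>
  have veq: "vmap h y = vmap h x" if "veq X x y" for x y
  proof -
    have xy: "x \<in> carrier X" "y \<in> carrier X" using that by (auto simp: veq_def)
    have "y = (y \<otimes>\<^bsub>X\<^esub> inv\<^bsub>X\<^esub> x) \<otimes>\<^bsub>X\<^esub> x" using xy by (simp add: X.m_assoc)
    then have "vmap h y = vmap h (y \<otimes>\<^bsub>X\<^esub> inv\<^bsub>X\<^esub> x) \<otimes>\<^bsub>Y\<^esub> vmap h x"
      using vhomD(2)[OF hh, of "y \<otimes>\<^bsub>X\<^esub> inv\<^bsub>X\<^esub> x" x] xy by simp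
    then show ?thesis
      using N veq_iff_Nset[OF X xy] that vhomD(1)[OF hh xy] by simp
  qed
  have h_rep: "vmap h (rep X x) = vmap h x" if "x \<in> carrier X" for x
    using veq[OF veq_rep[OF X that]] .
  have quot_rep: "is_vgroup tensor k (quot_rep X)" by (rule is_vgroup_quot_rep[OF X])
  define u where "u = VArrow (quot_rep X) Y (restrict (vmap h) (carrier (quot_rep X)))"
  have u: "u \<in> homset ?V (quot_rep X) Y"
    using quot_rep Y vhomD[OF hh] rep_carrier[OF X] h_rep
    by (auto simp: homset_VGrp u_def vhom_def hom_def vrel_rep[OF X] rep_mult_rep[OF X])
  have uq: "Comp ?V u (quot_arrow X) = h"
    by (rule VGrp_arrow_eqI[OF VGrp_Comp_homset[OF q u] h])
      (simp add: vmap_VGrp_Comp[OF q], simp add: quot_arrow_def u_def h_rep)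
  \<comment> \<open>Uniqueness holds because \<open>quot_arrow X\<close> is surjective onto the
    representatives.\<close>
  have "v = u" if v: "v \<in> homset ?V (quot_rep X) Y" and vq: "Comp ?V v (quot_arrow X) = h" for v
  proof (rule VGrp_arrow_eqI[OF v u])
    fix x assume "x \<in> carrier (quot_rep X)"
    then obtain a where a: "a \<in> carrier X" "x = vmap (quot_arrow X) a" by (auto simp: quot_arrow_def)
    then show "vmap v x = vmap u x"
      using vmap_VGrp_Comp[OF q a(1), of v] vmap_VGrp_Comp[OF q a(1), of u] vq uq by simp
  qed
  with u uq show ?thesis by blast
qed

text \<open>The factor is the same map with a smaller codomain, unique because the inclusion leaves
  values unchanged. It serves both the coreflection and the kernel.\<close>

lemma Nincl_universal:
  assumes X: "is_vgroup tensor k X" and h: "h \<in> homset (VGrp tensor k) Z X"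
    and N: "\<And>z. z \<in> carrier Z \<Longrightarrow> vmap h z \<in> Nset k X"
  shows "\<exists>!u. u \<in> homset (VGrp tensor k) Z (Nobj k X) \<and> Comp (VGrp tensor k) (Nincl k X) u = h"
proof -
  let ?V = "VGrp tensor k"
  have Z: "is_vgroup tensor k Z" and hh: "vmap h \<in> vhom Z X" "vmap h \<in> extensional (carrier Z)"
    using h by (auto simp: homset_VGrp)
  note i = Nincl_homset[OF X]
  have comp: "vmap (Comp ?V (Nincl k X) u) z = vmap u z"
    if u: "u \<in> homset ?V Z (Nobj k X)" and z: "z \<in> carrier Z" for u z
    using vmap_VGrp_Comp[OF u z] vhomD(1)[of "vmap u" Z "Nobj k X" z z] u z
    by (simp add: Nincl_def homset_VGrp)
  define u where "u = VArrow Z (Nobj k X) (vmap h)"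
  have u: "u \<in> homset ?V Z (Nobj k X)"
    using Z is_vgroup_Nobj[OF X] hh N by (auto simp: homset_VGrp u_def vhom_def hom_def)
  have uq: "Comp ?V (Nincl k X) u = h"
    by (rule VGrp_arrow_eqI[OF VGrp_Comp_homset[OF u i] h]) (simp add: comp[OF u], simp add: u_def)
  have "v = u" if v: "v \<in> homset ?V Z (Nobj k X)" and vq: "Comp ?V (Nincl k X) v = h" for v
    by (rule VGrp_arrow_eqI[OF v u]) (use comp[OF u] comp[OF v] uq vq in simp)
  with u uq show ?thesis by blast
qed

section \<open>Exactness and normality\<close>

lemma Nset_quot_arrow:
  assumes X: "is_vgroup tensor k X" and x: "x \<in> carrier X"
  shows "vmap (quot_arrow X) x = \<one>\<^bsub>quot_rep X\<^esub> \<longleftrightarrow> x \<in> Nset k X"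
proof -
  have "\<one>\<^bsub>X\<^esub> \<in> carrier X"
    using X by (simp add: is_vgroup_def group.is_monoid monoid.one_closed)
  then show ?thesis
    using rep_eq_iff[OF X _ x, of "\<one>\<^bsub>X\<^esub>"] x by (auto simp: quot_arrow_def mem_Nset[OF X])
qed

text \<open>A V-homomorphism fixes 1 and does not decrease a, and a value that is already the top k
  must stay k.\<close>

lemma vhom_Nset:
  assumes h: "h \<in> homset (VGrp tensor k) X Y" and x: "x \<in> Nset k X"
  shows "vmap h x \<in> Nset k Y"
proof -
  have V: "is_vgroup tensor k X" "is_vgroup tensor k Y" and hh: "vmap h \<in> vhom X Y"
    using h by (auto simp: homset_VGrp)
  have x': "veq X \<one>\<^bsub>X\<^esub> x" using x by (simp add: mem_Nset[OF V(1)])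
  then show ?thesis
    using vhomD[OF hh, of "\<one>\<^bsub>X\<^esub>" x] vhomD[OF hh, of x "\<one>\<^bsub>X\<^esub>"] vhom_one[OF V hh]
    by (simp add: mem_Nset[OF V(2)] veq_def k_le_iff)
qed

lemma Nset_separated:
  assumes "is_vgroup tensor k X" "separated k X" "x \<in> Nset k X"
  shows "x = \<one>\<^bsub>X\<^esub>"
  using assms separatedD[of X "\<one>\<^bsub>X\<^esub>" x] mem_Nset[of X x] by simp

lemma Nset_indiscrete:
  assumes "is_vgroup tensor k X" "indiscrete X"
  shows "Nset k X = carrier X"
proof -
  have "\<one>\<^bsub>X\<^esub> \<in> carrier X"
    using assms by (simp add: is_vgroup_def group.is_monoid monoid.one_closed)
  then show ?thesis using assms(2) by (auto simp: Nset_def indiscrete_def)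
qed

lemma Nincl_quot_arrow_exact:
  assumes X: "is_vgroup tensor k X"
  shows "zero_arr (VGrp tensor k) (Comp (VGrp tensor k) (quot_arrow X) (Nincl k X))"
  unfolding zero_arr_VGrp_iff[OF VGrp_Comp_homset[OF Nincl_homset[OF X] quot_arrow_homset[OF X]]]
  using Nset_quot_arrow[OF X] Nset_subset[OF X]
  by (auto simp: vmap_VGrp_Comp[OF Nincl_homset[OF X]]) (auto simp: Nincl_def)

text \<open>It is the cokernel of \<open>Nincl k X\<close>: a zero composite with the inclusion says
  precisely that the arrow kills N_X.\<close>

lemma normal_epi_quot_arrow:
  fixes X :: "('u, 'v) vgroup"
  assumes X: "is_vgroup tensor k X"
  shows "normal_epi (VGrp tensor k) (quot_arrow X)"
proof -
  let ?V = "VGrp tensor k :: (('u, 'v) vgroup, ('u, 'v) varrow) cat"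
  note i = Nincl_homset[OF X] and q = quot_arrow_homset[OF X]
  have "\<exists>!u. u \<in> homset ?V (quot_rep X) Y \<and> Comp ?V u (quot_arrow X) = h"
    if h: "h \<in> homset ?V X Y" and 0: "zero_arr ?V (Comp ?V h (Nincl k X))" for h Y
  proof (rule quot_arrow_universal[OF h])
    fix n assume "n \<in> Nset k X"
    then show "vmap h n = \<one>\<^bsub>Y\<^esub>"
      using 0 unfolding zero_arr_VGrp_iff[OF VGrp_Comp_homset[OF i h]]
      by (simp add: vmap_VGrp_Comp[OF i]) (simp add: Nincl_def)
  qed
  then have "is_cokernel ?V (Nincl k X) (quot_arrow X)"
    unfolding is_cokernel_def using homsetD[OF i] homsetD[OF q] Nincl_quot_arrow_exact[OF X]
    by (simp add: homset_def)
  then show ?thesis unfolding normal_epi_def by blast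
qed

text \<open>It is the kernel of \<open>quot_arrow X\<close>: a zero composite with the quotient puts
  all values of the arrow in N_X, by \<open>Nset_quot_arrow\<close>.\<close>

lemma normal_mono_Nincl:
  fixes X :: "('u, 'v) vgroup"
  assumes X: "is_vgroup tensor k X"
  shows "normal_mono (VGrp tensor k) (Nincl k X)"
proof -
  let ?V = "VGrp tensor k :: (('u, 'v) vgroup, ('u, 'v) varrow) cat"
  note i = Nincl_homset[OF X] and q = quot_arrow_homset[OF X]
  have "\<exists>!u. u \<in> homset ?V Z (Nobj k X) \<and> Comp ?V (Nincl k X) u = h"
    if h: "h \<in> homset ?V Z X" and 0: "zero_arr ?V (Comp ?V (quot_arrow X) h)" for h Z
  proof (rule Nincl_universal[OF X h])
    fix z assume z: "z \<in> carrier Z"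
    have "vmap h z \<in> carrier X" using h vhomD(1)[of "vmap h" Z X z z] z by (auto simp: homset_VGrp)
    then show "vmap h z \<in> Nset k X"
      using 0 z unfolding zero_arr_VGrp_iff[OF VGrp_Comp_homset[OF h q]]
      by (metis vmap_VGrp_Comp[OF h z] Nset_quot_arrow[OF X])
  qed
  then have "is_kernel ?V (quot_arrow X) (Nincl k X)"
    unfolding is_kernel_def using homsetD[OF i] homsetD[OF q] Nincl_quot_arrow_exact[OF X]
    by (simp add: homset_def)
  then show ?thesis unfolding normal_mono_def by blast
qed

section \<open>The two adjunctions\<close>

lemma reflection_separated:
  "\<exists>R. reflection (VGrp tensor k :: (('u, 'v) vgroup, ('u, 'v) varrow) cat) (separated k) R quot_arrow"
proof (rule reflection_if_universal_arrows[OF is_category_VGrp, where ?R0.0 = quot_rep])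
  fix X Y :: "('u, 'v) vgroup" and f
  assume f: "f \<in> homset (VGrp tensor k) X Y" and Y: "separated k Y"
  then have "is_vgroup tensor k Y" by (simp add: homset_VGrp)
  \<comment> \<open>The arrow maps N_X into N_Y, which is trivial as \<open>Y\<close> is separated,
    so it kills N_X.\<close>
  from Nset_separated[OF this Y vhom_Nset[OF f]]
  show "\<exists>!u. u \<in> homset (VGrp tensor k) (quot_rep X) Y \<and> Comp (VGrp tensor k) u (quot_arrow X) = f"
    by (rule quot_arrow_universal[OF f])
qed (simp_all add: is_vgroup_quot_rep separated_quot_rep quot_arrow_homset)

lemma coreflection_indiscrete:
  "\<exists>R. coreflection (VGrp tensor k :: (('u, 'v) vgroup, ('u, 'v) varrow) cat) indiscrete R (Nincl k)"
proof (rule coreflection_if_universal_arrows[OF is_category_VGrp, where ?R0.0 = "Nobj k"])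
  fix X Z :: "('u, 'v) vgroup" and f
  assume f: "f \<in> homset (VGrp tensor k) Z X" and Z: "indiscrete Z"
  then have V: "is_vgroup tensor k Z" "is_vgroup tensor k X" by (auto simp: homset_VGrp)
  \<comment> \<open>As \<open>Z\<close> is indiscrete, N_Z is all of \<open>Z\<close>, so the whole
    image of the arrow lies in N_X.\<close>
  from vhom_Nset[OF f, unfolded Nset_indiscrete[OF V(1) Z]]
  show "\<exists>!u. u \<in> homset (VGrp tensor k) Z (Nobj k X) \<and> Comp (VGrp tensor k) (Nincl k X) u = f"
    by (rule Nincl_universal[OF V(2) f])
qed (simp_all add: is_vgroup_Nobj indiscrete_Nobj Nincl_homset)

end

theorem corollary3p3:
  fixes tensor :: "'v::complete_lattice \<Rightarrow> 'v \<Rightarrow> 'v" and k :: 'v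
  assumes quantale: "comm_unital_quantale tensor k"
    and integral: "k = Orderings.top"
    and nontrivial: "(Orderings.bot :: 'v) \<noteq> Orderings.top"
    and frame: "is_frame TYPE('v)"
  defines "\<C> \<equiv> (VGrp tensor k :: (('u, 'v) vgroup, ('u, 'v) varrow) cat)"
  shows "(\<exists>R \<eta>. reflection \<C> (separated k) R \<eta> \<and>
            (\<forall>X\<in>Obj \<C>. is_quot_arrow k X (\<eta> X) \<and> normal_epi \<C> (\<eta> X))) \<and>
         (\<exists>R \<epsilon>. coreflection \<C> indiscrete R \<epsilon> \<and>
            (\<forall>X\<in>Obj \<C>. \<epsilon> X = Nincl k X \<and> normal_mono \<C> (\<epsilon> X)))"
proof -
  interpret integral_quantale tensor k
    using quantale integral by (simp add: integral_quantale_def integral_quantale_axioms_def)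
  obtain R S where "reflection \<C> (separated k) R quot_arrow" "coreflection \<C> indiscrete S (Nincl k)"
    using reflection_separated coreflection_indiscrete unfolding \<C>_def by blast
  then show ?thesis
    using is_quot_arrow_quot_arrow normal_epi_quot_arrow normal_mono_Nincl
    unfolding \<C>_def by (intro conjI exI) auto
qed

end
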